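(* Let $\nu>0$, $T>0$, $N$ a positive integer, $\Delta t=T/N$, $t_n=n\Delta t$, $f^n=f(t_n)\in L^2(\Omega)$, $u_0\in L^2(\Omega)$. Let $(\boldsymbol q_h^n,u_h^n,\widehat u_h^n)\in\boldsymbol Q_h\times V_h\times\widehat V_h$, $1\le n\le N$, solve the linearized backward Euler HDG scheme $$\boldsymbol q_h^n+\mathcal K_h(u_h^n,\widehat u_h^n)=0,$$ $$\Big(\frac{u_h^n-u_h^{n-1}}{\Delta t},w\Big)_{\mathcal T_h}+\nu(\mathcal K_h(u_h^n,\widehat u_h^n),\mathcal K_h(w,\mu))_{\mathcal T_h}+\mathcal S_h(u_h^n,\widehat u_h^n;w,\mu)+\mathcal B_h(u_h^{n-1};u_h^n,\widehat u_h^n;w,\mu)=(f^n,w)_{\mathcal T_h}$$ for all $(w,\mu)\in V_h\times\widehat V_h$, with $u_h^0=\Pi_k^o u_0$. Then there is a constant $C>0$, independent of $h$ and $\Delta t$, such that for any $1\le n\le N$ $$\|u_h^n\|_{0,\mathcal T_h}^2+\sum_{i=1}^n\|u_h^i-u_h^{i-1}\|_{0,\mathcal T_h}^2+\nu\Delta t\sum_{i=1}^n|||(u_h^i,\widehat u_h^i)|||^2\le C\Big(\|u_h^0\|_{0,\mathcal T_h}^2+\frac{\Delta t}{\nu}\sum_{i=1}^n\|f^i\|_{0,\mathcal T_h}^2\Big).$$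
   Context: $\Omega\subset\mathbb R^d$ ($d=2,3$) is a polyhedral domain. $\mathcal T_h=\{K\}$ is a partition of $\Omega$ into open polygons/polyhedra; $h_K$ is the infimum of the diameters of circles (spheres) containing $K$, $h=\max_K h_K$. The partition is shape-regular: there are constants $\theta_*,l_*>0$ such that each $K$ is star-shaped with respect to every point of some circle (sphere) centered at a point of $K$ with radius $\theta_*h_K$, and the distance between any two vertices of $K$ is at least $l_*h_K$. $\varepsilon_h$ is the set of all edges/faces and $\varepsilon_h^\partial$ the set of those on $\partial\Omega$; $\boldsymbol n$ is the unit outward normal to $\partial K$. Inner products and norms: $(u,v)_{\mathcal T_h}=\sum_K\int_K uv$, $\langle u,v\rangle_{\partial\mathcal T_h}=\sum_K\int_{\partial K}uv$ (componentwise for vectors), $\|u\|_{0,\mathcal T_h}^2=\sum_K\|u\|_{L^2(K)}^2$, $\|u\|_{0,\partial\mathcal T_h}^2=\sum_K\|u\|_{L^2(\partial K)}^2$. For integers $k\ge1$, $l\in\{k-1,k\}$: $\boldsymbol Q_h=\{\boldsymbol v\in[L^2(\Omega)]^d:\boldsymbol v|_K\in[P_{k-1}(K)]^d\ \forall K\}$, $V_h=\{v\in L^2(\Omega):v|_K\in P_k(K)\ \forall K\}$, $\widehat V_h=\{\widehat v\in L^2(\varepsilon_h):\widehat v|_E\in P_l(E)\ \forall E\in\varepsilon_h,\ \widehat v|_{\varepsilon_h^\partial}=0\}$, where $P_m(D)$ denotes polynomials of degree at most $m$ on $D$. $\Pi_k^o$ is the elementwise $L^2$ projection onto $V_h$;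 $\Pi_l^\partial$ is the facewise $L^2$ projection onto polynomials of degree $\le l$ (applied on each $\partial K$ to traces from $K$). $\mathcal K_h:V_h\times\widehat V_h\to\boldsymbol Q_h$ is defined by $(\mathcal K_h(w,\mu),\boldsymbol r)_{\mathcal T_h}=-(w,\nabla_h\cdot\boldsymbol r)_{\mathcal T_h}+\langle\mu,\boldsymbol r\cdot\boldsymbol n\rangle_{\partial\mathcal T_h}$ for all $\boldsymbol r\in\boldsymbol Q_h$ ($\nabla_h\cdot$ the elementwise divergence). $\mathcal S_h(u_h,\widehat u_h;w,\mu)=\nu\langle\tau(\Pi_l^\partial u_h-\widehat u_h),\Pi_l^\partial w-\mu\rangle_{\partial\mathcal T_h}$ with $\tau|_{\partial K}=h_K^{-1}$. $\boldsymbol b(v)=[v,\dots,v]^T\in\mathbb R^d$, and $\mathcal B_h(v_h;u_h,\widehat u_h;w,\mu)=-\frac13(\boldsymbol b(v_h)u_h,\nabla w)_{\mathcal T_h}+\frac13(\boldsymbol b(v_h)\cdot\nabla u_h,w)_{\mathcal T_h}-\frac13\langle\boldsymbol b(v_h)\cdot\boldsymbol n\,u_h,\mu\rangle_{\partial\mathcal T_h}+\frac13\langle\boldsymbol b(v_h)\cdot\boldsymbol n\,\widehat u_h,w\rangle_{\partial\mathcal T_h}$ (gradients elementwise). Norm on $V_h\times\widehat V_h$: $|||(w,\mu)|||^2=\|\mathcal K_h(w,\mu)\|_{0,\mathcal T_h}^2+\|\tau^{1/2}(\Pi_l^\partial w-\mu)\|_{0,\partial\mathcal T_h}^2$. *)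

theory Defs
  imports "HOL-Analysis.Analysis"
begin

section \<open>Surface measure\<close>

definition hausdorff_pre :: "nat \<Rightarrow> real \<Rightarrow> 'a::euclidean_space set \<Rightarrow> ennreal" where
  "hausdorff_pre s \<delta> A =
     (INF U\<in>{U :: nat \<Rightarrow> 'a set. A \<subseteq> (\<Union>i. U i) \<and> (\<forall>i. bounded (U i) \<and> diameter (U i) \<le> \<delta>)}.
        \<Sum>i. ennreal (unit_ball_vol (real s) * (diameter (U i) / 2) ^ s))"

text \<open>
  The \<open>(d - 1)\<close>-dimensional Hausdorff measure on the Borel sets of \<open>d\<close>-dimensional space, normalised
  to agree with \<open>(d - 1)\<close>-dimensional Lebesgue measure on hyperplanes.  The set function is a metric
  outer measure, hence countably additive on Borel sets, so \<open>measure_of\<close> does not degenerate.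
  (The empty set has diameter 0, so padding a cover with empty sets is free as \<open>d > 1\<close>.)
\<close>
definition surface_measure :: "'a::euclidean_space measure" where
  "surface_measure = measure_of UNIV (sets borel)
     (\<lambda>A. SUP \<delta>\<in>{0<..}. hausdorff_pre (DIM('a) - 1) \<delta> A)"


section \<open>Polyhedral domains and meshes\<close>

text \<open>
  A not necessarily convex, relatively open, connected polyhedron in an affine subspace; the
  condition on \<open>rel_interior\<close> excludes slits.
\<close>
definition polyhedral_cell :: "'a::euclidean_space set \<Rightarrow> bool" where
  "polyhedral_cell S \<longleftrightarrow> S \<noteq> {} \<and> connected S \<and> rel_interior (closure S) = S \<and>
     (\<exists>\<P>. finite \<P> \<and> (\<forall>P\<in>\<P>. polytope P) \<and> closure S = \<Union>\<P>)"

text \<open>Open polygons (\<open>d = 2\<close>) and polyhedra (\<open>d = 3\<close>).\<close>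
definition polyhedral_domain :: "'a::euclidean_space set \<Rightarrow> bool" where
  "polyhedral_domain S \<longleftrightarrow> polyhedral_cell S \<and> aff_dim S = int DIM('a)"

text \<open>Open edges (\<open>d = 2\<close>) and open flat faces (\<open>d = 3\<close>).\<close>
definition polyhedral_facet :: "'a::euclidean_space set \<Rightarrow> bool" where
  "polyhedral_facet F \<longleftrightarrow> polyhedral_cell F \<and> aff_dim F = int DIM('a) - 1"

text \<open>
  The vertices of a polyhedral set are the points around which the set is not locally invariant
  under translation in any direction.  (For nonconvex sets \<open>extreme_point_of\<close> would miss
  reentrant vertices.)
\<close>
definition corners :: "'a::euclidean_space set \<Rightarrow> 'a set" where
  "corners S = {x \<in> S. \<not> (\<exists>v e. v \<noteq> 0 \<and> 0 < e \<and>
     (\<forall>y\<in>ball x e. \<forall>t. y + t *\<^sub>R v \<in> ball x e \<longrightarrow> (y \<in> S \<longleftrightarrow> y + t *\<^sub>R v \<in> S)))}"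

definition facets_of :: "'a::euclidean_space set set \<Rightarrow> 'a set \<Rightarrow> 'a set set" where
  "facets_of \<E> K = {F \<in> \<E>. F \<subseteq> frontier K}"

definition vertices_of :: "'a::euclidean_space set set \<Rightarrow> 'a set \<Rightarrow> 'a set" where
  "vertices_of \<E> K = (\<Union>F\<in>facets_of \<E> K. corners (closure F))"

text \<open>
  The facets are kept as part of the mesh, so that hanging nodes are allowed: a geometrically
  straight side of an element may consist of several facets.  Facets are relatively open, hence
  disjoint, and a function on the skeleton is a function on the ambient space of which only the
  values on facets matter.
\<close>
definition polytopal_mesh ::
    "'a::euclidean_space set \<Rightarrow> 'a set set \<Rightarrow> 'a set set \<Rightarrow> bool" where
  "polytopal_mesh \<Omega> \<T> \<E> \<longleftrightarrow>
     finite \<T> \<and> (\<forall>K\<in>\<T>. polyhedral_domain K \<and> K \<subseteq> \<Omega>) \<and> disjoint \<T> \<and>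
     closure \<Omega> = (\<Union>K\<in>\<T>. closure K) \<and>
     finite \<E> \<and> (\<forall>F\<in>\<E>. polyhedral_facet F) \<and> disjoint \<E> \<and>
     (\<forall>F\<in>\<E>. F \<subseteq> \<Omega> \<or> F \<subseteq> frontier \<Omega>) \<and>
     (\<forall>F\<in>\<E>. \<exists>K\<in>\<T>. F \<in> facets_of \<E> K) \<and>
     (\<forall>K\<in>\<T>. frontier K = (\<Union>F\<in>facets_of \<E> K. closure F))"

definition elem_size :: "'a::euclidean_space set \<Rightarrow> real" where
  "elem_size K = Inf {2 * r | r. \<exists>z. K \<subseteq> cball z r}"

definition shape_regular ::
    "real \<Rightarrow> real \<Rightarrow> 'a::euclidean_space set set \<Rightarrow> 'a set set \<Rightarrow> bool" where
  "shape_regular \<theta> lstar \<T> \<E> \<longleftrightarrow> (\<forall>K\<in>\<T>.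
     (\<exists>z\<in>K. \<forall>y\<in>ball z (\<theta> * elem_size K). \<forall>x\<in>K. closed_segment y x \<subseteq> K) \<and>
     (\<forall>a\<in>vertices_of \<E> K. \<forall>b\<in>vertices_of \<E> K. a \<noteq> b \<longrightarrow> lstar * elem_size K \<le> dist a b))"

text \<open>The halfspace that \<open>K\<close> coincides with near a point of a facet determines the normal.\<close>
definition outer_normal :: "'a::euclidean_space set \<Rightarrow> 'a \<Rightarrow> 'a" where
  "outer_normal K x = (THE n. norm n = 1 \<and>
     (\<exists>e>0. \<forall>y\<in>ball x e. y \<in> K \<longleftrightarrow> n \<bullet> (y - x) < 0))"


section \<open>Discrete spaces, inner products and projections\<close>

definition L2_on :: "'a measure \<Rightarrow> 'a set \<Rightarrow> ('a \<Rightarrow> 'b::euclidean_space) set" where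
  "L2_on M S = {u. set_borel_measurable M S u \<and> set_integrable M S (\<lambda>x. (norm (u x))\<^sup>2)}"

text \<open>Functions whose restriction to \<open>D\<close> is a polynomial of degree at most \<open>m\<close>.\<close>
definition poly_on :: "nat \<Rightarrow> (real^'d) set \<Rightarrow> (real^'d \<Rightarrow> real) set" where
  "poly_on m D = {p. \<exists>c :: ('d \<Rightarrow> nat) \<Rightarrow> real. \<forall>x\<in>D.
     p x = (\<Sum>\<alpha> | (\<Sum>i\<in>UNIV. \<alpha> i) \<le> m. c \<alpha> * (\<Prod>i\<in>UNIV. (x $ i) ^ \<alpha> i))}"

definition Q_space :: "(real^'d) set \<Rightarrow> (real^'d) set set \<Rightarrow> nat \<Rightarrow> (real^'d \<Rightarrow> real^'d) set" where
  "Q_space \<Omega> \<T> k = {v \<in> L2_on lebesgue \<Omega>. \<forall>K\<in>\<T>. \<forall>i. (\<lambda>x. v x $ i) \<in> poly_on (k - 1) K}"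

definition V_space :: "(real^'d) set \<Rightarrow> (real^'d) set set \<Rightarrow> nat \<Rightarrow> (real^'d \<Rightarrow> real) set" where
  "V_space \<Omega> \<T> k = {v \<in> L2_on lebesgue \<Omega>. \<forall>K\<in>\<T>. v \<in> poly_on k K}"

definition Vhat_space :: "(real^'d) set \<Rightarrow> (real^'d) set set \<Rightarrow> nat \<Rightarrow> (real^'d \<Rightarrow> real) set" where
  "Vhat_space \<Omega> \<E> l = {\<mu>. \<forall>F\<in>\<E>. \<mu> \<in> L2_on surface_measure F \<and> \<mu> \<in> poly_on l F \<and>
     (F \<subseteq> frontier \<Omega> \<longrightarrow> (\<forall>x\<in>F. \<mu> x = 0))}"

definition vol_ip ::
    "(real^'d) set set \<Rightarrow> (real^'d \<Rightarrow> 'b) \<Rightarrow> (real^'d \<Rightarrow> 'b::real_inner) \<Rightarrow> real" where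
  "vol_ip \<T> u v = (\<Sum>K\<in>\<T>. (LINT x:K|lebesgue. u x \<bullet> v x))"

text \<open>
  The arguments depend on the element as well, since traces and normals are taken from the
  element whose boundary is being integrated over.
\<close>
definition bdry_ip :: "(real^'d) set set \<Rightarrow> (real^'d) set set \<Rightarrow>
    ((real^'d) set \<Rightarrow> real^'d \<Rightarrow> 'b) \<Rightarrow> ((real^'d) set \<Rightarrow> real^'d \<Rightarrow> 'b::real_inner) \<Rightarrow> real" where
  "bdry_ip \<T> \<E> u v =
     (\<Sum>K\<in>\<T>. \<Sum>F\<in>facets_of \<E> K. (LINT x:F|surface_measure. u K x \<bullet> v K x))"

definition vol_norm_sq :: "(real^'d) set set \<Rightarrow> (real^'d \<Rightarrow> 'b::real_inner) \<Rightarrow> real" where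
  "vol_norm_sq \<T> u = (\<Sum>K\<in>\<T>. (LINT x:K|lebesgue. (norm (u x))\<^sup>2))"

definition bdry_norm_sq :: "(real^'d) set set \<Rightarrow> (real^'d) set set \<Rightarrow>
    ((real^'d) set \<Rightarrow> real^'d \<Rightarrow> 'b::real_inner) \<Rightarrow> real" where
  "bdry_norm_sq \<T> \<E> u =
     (\<Sum>K\<in>\<T>. \<Sum>F\<in>facets_of \<E> K. (LINT x:F|surface_measure. (norm (u K x))\<^sup>2))"

text \<open>\<open>v\<close> is the elementwise \<open>L\<^sup>2\<close> projection of \<open>g\<close> (determined on the elements).\<close>
definition is_vol_proj :: "(real^'d) set \<Rightarrow> (real^'d) set set \<Rightarrow> nat \<Rightarrow>
    (real^'d \<Rightarrow> real) \<Rightarrow> (real^'d \<Rightarrow> real) \<Rightarrow> bool" where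
  "is_vol_proj \<Omega> \<T> k g v \<longleftrightarrow>
     v \<in> V_space \<Omega> \<T> k \<and> (\<forall>w\<in>V_space \<Omega> \<T> k. vol_ip \<T> v w = vol_ip \<T> g w)"

text \<open>
  Facewise \<open>L\<^sup>2\<close> projection of a function \<open>g\<close> on the boundary of \<open>K\<close>.  The choice is unique on
  the facets of \<open>K\<close>, and its values elsewhere are never used.
\<close>
definition bdry_proj :: "(real^'d) set set \<Rightarrow> nat \<Rightarrow> (real^'d) set \<Rightarrow>
    (real^'d \<Rightarrow> real) \<Rightarrow> real^'d \<Rightarrow> real" where
  "bdry_proj \<E> l K g = (SOME p. \<forall>F\<in>facets_of \<E> K. p \<in> poly_on l F \<and>
     (\<forall>q\<in>poly_on l F. (LINT x:F|surface_measure. p x * q x) =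
                      (LINT x:F|surface_measure. g x * q x)))"

text \<open>
  Elements are open and discrete functions are polynomial on them, so boundary values are limits
  from inside the element, and derivatives at points of an element are the elementwise ones.
\<close>
definition trace_from :: "(real^'d) set \<Rightarrow> (real^'d \<Rightarrow> 'b::t2_space) \<Rightarrow> real^'d \<Rightarrow> 'b" where
  "trace_from K u x = Lim (at x within K) u"

definition grad :: "(real^'d \<Rightarrow> real) \<Rightarrow> real^'d \<Rightarrow> real^'d" where
  "grad u x = (\<chi> i. frechet_derivative u (at x) (axis i 1))"

definition divg :: "(real^'d \<Rightarrow> real^'d) \<Rightarrow> real^'d \<Rightarrow> real" where
  "divg r x = (\<Sum>i\<in>UNIV. frechet_derivative r (at x) (axis i 1) $ i)"


section \<open>The HDG scheme\<close>

text \<open>The Riesz representative in \<open>Q_space\<close>; it is unique on the elements.\<close>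
definition K_op :: "(real^'d) set \<Rightarrow> (real^'d) set set \<Rightarrow> (real^'d) set set \<Rightarrow> nat \<Rightarrow>
    (real^'d \<Rightarrow> real) \<Rightarrow> (real^'d \<Rightarrow> real) \<Rightarrow> real^'d \<Rightarrow> real^'d" where
  "K_op \<Omega> \<T> \<E> k w \<mu> = (SOME q. q \<in> Q_space \<Omega> \<T> k \<and>
     (\<forall>r\<in>Q_space \<Omega> \<T> k. vol_ip \<T> q r =
        - vol_ip \<T> w (divg r)
        + bdry_ip \<T> \<E> (\<lambda>K. \<mu>) (\<lambda>K x. trace_from K r x \<bullet> outer_normal K x)))"

definition S_form :: "(real^'d) set set \<Rightarrow> (real^'d) set set \<Rightarrow> nat \<Rightarrow> real \<Rightarrow>
    (real^'d \<Rightarrow> real) \<Rightarrow> (real^'d \<Rightarrow> real) \<Rightarrow> (real^'d \<Rightarrow> real) \<Rightarrow> (real^'d \<Rightarrow> real) \<Rightarrow> real" where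
  "S_form \<T> \<E> l \<nu> u u' w \<mu> = \<nu> * bdry_ip \<T> \<E>
     (\<lambda>K x. inverse (elem_size K) * (bdry_proj \<E> l K (trace_from K u) x - u' x))
     (\<lambda>K x. bdry_proj \<E> l K (trace_from K w) x - \<mu> x)"

definition b_vec :: "real \<Rightarrow> real^'d" where
  "b_vec s = (\<chi> i. s)"

definition B_form :: "(real^'d) set set \<Rightarrow> (real^'d) set set \<Rightarrow> (real^'d \<Rightarrow> real) \<Rightarrow>
    (real^'d \<Rightarrow> real) \<Rightarrow> (real^'d \<Rightarrow> real) \<Rightarrow> (real^'d \<Rightarrow> real) \<Rightarrow> (real^'d \<Rightarrow> real) \<Rightarrow> real" where
  "B_form \<T> \<E> v u u' w \<mu> =
     - (1/3) * vol_ip \<T> (\<lambda>x. u x *\<^sub>R b_vec (v x)) (grad w)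
     + (1/3) * vol_ip \<T> (\<lambda>x. b_vec (v x) \<bullet> grad u x) w
     - (1/3) * bdry_ip \<T> \<E>
         (\<lambda>K x. (b_vec (trace_from K v x) \<bullet> outer_normal K x) * trace_from K u x) (\<lambda>K. \<mu>)
     + (1/3) * bdry_ip \<T> \<E>
         (\<lambda>K x. (b_vec (trace_from K v x) \<bullet> outer_normal K x) * u' x) (\<lambda>K. trace_from K w)"

definition energy_norm_sq :: "(real^'d) set \<Rightarrow> (real^'d) set set \<Rightarrow> (real^'d) set set \<Rightarrow>
    nat \<Rightarrow> nat \<Rightarrow> (real^'d \<Rightarrow> real) \<Rightarrow> (real^'d \<Rightarrow> real) \<Rightarrow> real" where
  "energy_norm_sq \<Omega> \<T> \<E> k l w \<mu> =
     vol_norm_sq \<T> (K_op \<Omega> \<T> \<E> k w \<mu>)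
     + bdry_norm_sq \<T> \<E> (\<lambda>K x. sqrt (inverse (elem_size K)) *
         (bdry_proj \<E> l K (trace_from K w) x - \<mu> x))"

text \<open>
  \<open>f n\<close> is the source at the \<open>n\<close>-th time level; \<open>u'\<close> is the numerical trace.
\<close>
definition euler_hdg_solution :: "(real^'d) set \<Rightarrow> (real^'d) set set \<Rightarrow> (real^'d) set set \<Rightarrow>
    nat \<Rightarrow> nat \<Rightarrow> real \<Rightarrow> real \<Rightarrow> nat \<Rightarrow> (nat \<Rightarrow> real^'d \<Rightarrow> real) \<Rightarrow> (real^'d \<Rightarrow> real) \<Rightarrow>
    (nat \<Rightarrow> real^'d \<Rightarrow> real^'d) \<Rightarrow> (nat \<Rightarrow> real^'d \<Rightarrow> real) \<Rightarrow> (nat \<Rightarrow> real^'d \<Rightarrow> real) \<Rightarrow> bool" where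
  "euler_hdg_solution \<Omega> \<T> \<E> k l \<nu> \<Delta>t N f u0 q u u' \<longleftrightarrow>
     is_vol_proj \<Omega> \<T> k u0 (u 0) \<and>
     (\<forall>n\<in>{1..N}.
        q n \<in> Q_space \<Omega> \<T> k \<and> u n \<in> V_space \<Omega> \<T> k \<and> u' n \<in> Vhat_space \<Omega> \<E> l \<and>
        (\<forall>x\<in>\<Union>\<T>. q n x + K_op \<Omega> \<T> \<E> k (u n) (u' n) x = 0) \<and>
        (\<forall>w\<in>V_space \<Omega> \<T> k. \<forall>\<mu>\<in>Vhat_space \<Omega> \<E> l.
           vol_ip \<T> (\<lambda>x. (u n x - u (n - 1) x) / \<Delta>t) w
           + \<nu> * vol_ip \<T> (K_op \<Omega> \<T> \<E> k (u n) (u' n)) (K_op \<Omega> \<T> \<E> k w \<mu>)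
           + S_form \<T> \<E> l \<nu> (u n) (u' n) w \<mu>
           + B_form \<T> \<E> (u (n - 1)) (u n) (u' n) w \<mu>
           = vol_ip \<T> (f n) w))"

end

theory Submission
  imports Defs
begin

text \<open>
  Testing the \<open>n\<close>-th step of the scheme with its own solution \<open>(u n, u' n)\<close> makes the convection
  form disappear: it is antisymmetric in its two argument pairs, so that on the diagonal its four
  integrands cancel in pairs (lemma \<open>B_form_diagonal\<close>).  The diffusion form together with the
  stabilisation is \<open>\<nu>\<close> times the squared energy norm (lemma \<open>S_form_diagonal\<close>), and
  \<open>2 (a - b) a = a\<^sup>2 - b\<^sup>2 + (a - b)\<^sup>2\<close> turns the difference quotient into a telescoping
  term plus the squared increment.  With the Cauchy-Schwarz inequality on the right-hand side this
  is the energy inequality (lemma \<open>euler_step_energy\<close>)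
  \<open>\<parallel>u\<^sup>n\<parallel>\<^sup>2 - \<parallel>u\<^sup>n\<^sup>-\<^sup>1\<parallel>\<^sup>2 + \<parallel>u\<^sup>n - u\<^sup>n\<^sup>-\<^sup>1\<parallel>\<^sup>2 + 2 \<nu> \<Delta>t |||(u\<^sup>n, u'\<^sup>n)|||\<^sup>2 \<le> 2 \<Delta>t \<parallel>f\<^sup>n\<parallel> \<parallel>u\<^sup>n\<parallel>\<close>.

  The factor \<open>\<parallel>u\<^sup>n\<parallel>\<close> on the right could be absorbed into the energy norm by a discrete Poincare
  inequality.  Since the constant may depend on \<open>\<nu>\<close> and on the final time \<open>T\<close>, there is a more
  elementary way: dropping the nonnegative terms shows that \<open>\<parallel>u\<^sup>n\<parallel>\<close> grows by at most
  \<open>2 \<Delta>t \<parallel>f\<^sup>n\<parallel>\<close> per step, which bounds \<open>\<parallel>u\<^sup>n\<parallel>\<close> by \<open>\<parallel>u\<^sup>0\<parallel> + 2 \<Delta>t \<Sum>\<parallel>f\<^sup>i\<parallel>\<close>; summing the energy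
  inequality with this bound and \<open>(\<Delta>t \<Sum>\<parallel>f\<^sup>i\<parallel>)\<^sup>2 \<le> T \<Delta>t \<Sum>\<parallel>f\<^sup>i\<parallel>\<^sup>2\<close> gives the estimate with
  \<open>C = 2 + 8 \<nu> T\<close> (lemma \<open>discrete_energy_estimate\<close>).
\<close>

section \<open>Square-integrable functions on a mesh\<close>

lemma polyhedral_domain_open:
  fixes K :: "'a::euclidean_space set"
  assumes "polyhedral_domain K"
  shows "open K"
proof -
  have "affine hull (closure K) = UNIV"
    using assms by (simp add: polyhedral_domain_def flip: aff_dim_eq_full)
  then have "rel_interior (closure K) = interior (closure K)"
    by (rule rel_interior_interior)
  then show ?thesis
    using assms unfolding polyhedral_domain_def polyhedral_cell_def by (metis open_interior)
qed

lemma polyhedral_domain_bounded: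
  assumes "polyhedral_domain K"
  shows "bounded K"
proof -
  obtain \<P> where "finite \<P>" "\<forall>P\<in>\<P>. polytope P" "closure K = \<Union>\<P>"
    using assms unfolding polyhedral_domain_def polyhedral_cell_def by blast
  then have "bounded (closure K)"
    by (auto intro: bounded_Union polytope_imp_bounded)
  then show ?thesis
    using bounded_subset closure_subset by blast
qed

text \<open>
  Boundedness matters: without it the infimum would be taken over the empty set, about which
  nothing is known.
\<close>
lemma elem_size_nonneg:
  assumes "polyhedral_domain K"
  shows "0 \<le> elem_size K"
  unfolding elem_size_def
proof (rule cInf_greatest)
  obtain z r where "K \<subseteq> cball z r"
    using polyhedral_domain_bounded[OF assms] bounded_subset_cball by blast
  then show "{2 * r |r. \<exists>z. K \<subseteq> cball z r} \<noteq> {}"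
    by blast
next
  have "K \<noteq> {}"
    using assms unfolding polyhedral_domain_def polyhedral_cell_def by blast
  then show "0 \<le> x" if "x \<in> {2 * r |r. \<exists>z. K \<subseteq> cball z r}" for x
    using that by force
qed

lemma L2_on_subset:
  assumes u: "u \<in> L2_on M S" and "A \<subseteq> S" "A \<in> sets M"
  shows "u \<in> L2_on M A"
proof -
  have "(\<lambda>x. indicator A x *\<^sub>R (indicator S x *\<^sub>R u x)) \<in> borel_measurable M"
    using u \<open>A \<in> sets M\<close> unfolding L2_on_def set_borel_measurable_def
    by (auto simp del: scaleR_scaleR)
  also have "(\<lambda>x. indicator A x *\<^sub>R (indicator S x *\<^sub>R u x)) = (\<lambda>x. indicator A x *\<^sub>R u x)"
    using \<open>A \<subseteq> S\<close> by (auto simp: indicator_def fun_eq_iff)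
  finally have "set_borel_measurable M A u"
    unfolding set_borel_measurable_def .
  moreover have "set_integrable M A (\<lambda>x. (norm (u x))\<^sup>2)"
    using u assms(2,3) unfolding L2_on_def by (blast intro: set_integrable_subset)
  ultimately show ?thesis
    unfolding L2_on_def by simp
qed

lemma L2_on_inner_integrable:
  assumes u: "u \<in> L2_on M S" and v: "v \<in> L2_on M S"
  shows "set_integrable M S (\<lambda>x. u x \<bullet> v x)"
proof -
  have "integrable M (\<lambda>x. indicator S x *\<^sub>R (norm (u x))\<^sup>2 + indicator S x *\<^sub>R (norm (v x))\<^sup>2)"
    using u v unfolding L2_on_def set_integrable_def by auto
  moreover have "(\<lambda>x. (indicator S x *\<^sub>R u x) \<bullet> (indicator S x *\<^sub>R v x)) \<in> borel_measurable M"
    using u v unfolding L2_on_def set_borel_measurable_def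
    by (auto simp del: inner_scaleR_left inner_scaleR_right)
  then have "(\<lambda>x. indicator S x *\<^sub>R (u x \<bullet> v x)) \<in> borel_measurable M"
    by (rule back_subst[of "\<lambda>g. g \<in> borel_measurable M"]) (auto simp: indicator_def fun_eq_iff)
  moreover have "norm (a \<bullet> b) \<le> norm ((norm a)\<^sup>2 + (norm b)\<^sup>2)" for a b :: 'b
  proof -
    have "\<bar>a \<bullet> b\<bar> \<le> norm a * norm b"
      by (rule Cauchy_Schwarz_ineq2)
    also have "\<dots> \<le> 2 * norm a * norm b"
      by simp
    also have "\<dots> \<le> (norm a)\<^sup>2 + (norm b)\<^sup>2"
      by (rule sum_squares_bound)
    finally show ?thesis
      by simp
  qed
  then have "norm (indicator S x *\<^sub>R (u x \<bullet> v x)) \<le>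
      norm (indicator S x *\<^sub>R (norm (u x))\<^sup>2 + indicator S x *\<^sub>R (norm (v x))\<^sup>2)" for x
    by (simp add: indicator_def)
  ultimately show ?thesis
    unfolding set_integrable_def by (blast intro: Bochner_Integration.integrable_bound)
qed

text \<open>
  The part of the mesh axioms on which the volume terms depend: integrals over elements of products
  of functions from \<open>L\<^sup>2(\<Omega>)\<close> are then integrals of integrable functions, so that the volume inner
  product is bilinear.
\<close>
locale open_elements =
  fixes \<Omega> :: "(real^'d) set" and \<T> :: "(real^'d) set set"
  assumes open_element: "K \<in> \<T> \<Longrightarrow> open K"
    and element_subset: "K \<in> \<T> \<Longrightarrow> K \<subseteq> \<Omega>"
begin

lemma inner_integrable:
  assumes "u \<in> L2_on lebesgue \<Omega>" "v \<in> L2_on lebesgue \<Omega>" "K \<in> \<T>"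
  shows "set_integrable lebesgue K (\<lambda>x. u x \<bullet> v x)"
proof -
  have "K \<in> sets lebesgue"
    using open_element[OF \<open>K \<in> \<T>\<close>] by simp
  then show ?thesis
    using assms element_subset by (blast intro: L2_on_inner_integrable L2_on_subset)
qed

lemma vol_ip_diff_scaled:
  assumes "u \<in> L2_on lebesgue \<Omega>" "v \<in> L2_on lebesgue \<Omega>" "w \<in> L2_on lebesgue \<Omega>"
  shows "vol_ip \<T> (\<lambda>x. c *\<^sub>R (u x - v x)) w = c * (vol_ip \<T> u w - vol_ip \<T> v w)"
proof -
  have "(LINT x:K|lebesgue. (c *\<^sub>R (u x - v x)) \<bullet> w x) =
      c * ((LINT x:K|lebesgue. u x \<bullet> w x) - (LINT x:K|lebesgue. v x \<bullet> w x))" if "K \<in> \<T>" for K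
    using inner_integrable[OF assms(1,3) that] inner_integrable[OF assms(2,3) that]
    by (simp add: inner_diff_left)
  then have "vol_ip \<T> (\<lambda>x. c *\<^sub>R (u x - v x)) w = (\<Sum>K\<in>\<T>.
      c * ((LINT x:K|lebesgue. u x \<bullet> w x) - (LINT x:K|lebesgue. v x \<bullet> w x)))"
    unfolding vol_ip_def by (rule sum.cong[OF refl])
  then show ?thesis
    unfolding vol_ip_def by (simp only: sum_subtractf flip: sum_distrib_left)
qed

lemma vol_norm_sq_diff_scaled:
  assumes "u \<in> L2_on lebesgue \<Omega>" "v \<in> L2_on lebesgue \<Omega>"
  shows "vol_norm_sq \<T> (\<lambda>x. u x - t *\<^sub>R v x) =
    vol_norm_sq \<T> u - 2 * t * vol_ip \<T> u v + t\<^sup>2 * vol_norm_sq \<T> v"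
proof -
  have "(LINT x:K|lebesgue. (norm (u x - t *\<^sub>R v x))\<^sup>2) =
      (LINT x:K|lebesgue. (norm (u x))\<^sup>2) - 2 * t * (LINT x:K|lebesgue. u x \<bullet> v x)
      + t\<^sup>2 * (LINT x:K|lebesgue. (norm (v x))\<^sup>2)" if "K \<in> \<T>" for K
  proof -
    have "(norm (u x - t *\<^sub>R v x))\<^sup>2 =
        u x \<bullet> u x - (2 * t) * (u x \<bullet> v x) + t\<^sup>2 * (v x \<bullet> v x)" for x
      unfolding power2_norm_eq_inner
      by (simp add: inner_diff inner_commute power2_eq_square algebra_simps)
    then show ?thesis
      using inner_integrable[OF assms(1,1) that] inner_integrable[OF assms(1,2) that]
        inner_integrable[OF assms(2,2) that]
      by (simp add: set_integral_add set_integral_diff)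
        (simp add: power2_norm_eq_inner)
  qed
  then show ?thesis
    unfolding vol_norm_sq_def vol_ip_def
    by (simp add: sum_subtractf sum.distrib flip: sum_distrib_left)
qed

end

lemma vol_norm_sq_nonneg: "0 \<le> vol_norm_sq \<T> u"
  unfolding vol_norm_sq_def set_lebesgue_integral_def
  by (intro sum_nonneg Bochner_Integration.integral_nonneg) simp

lemma vol_ip_self: "vol_ip \<T> u u = vol_norm_sq \<T> u"
  unfolding vol_ip_def vol_norm_sq_def by (simp add: power2_norm_eq_inner)

lemma vol_ip_commute: "vol_ip \<T> u v = vol_ip \<T> v u"
  unfolding vol_ip_def by (simp add: inner_commute)

text \<open>
  The discriminant argument: \<open>\<parallel>u - t v\<parallel>\<^sup>2\<close> is a nonnegative quadratic polynomial in \<open>t\<close>.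
\<close>
lemma (in open_elements) vol_ip_Cauchy_Schwarz:
  assumes "u \<in> L2_on lebesgue \<Omega>" "v \<in> L2_on lebesgue \<Omega>"
  shows "vol_ip \<T> u v \<le> sqrt (vol_norm_sq \<T> u) * sqrt (vol_norm_sq \<T> v)"
proof -
  define A B p where "A = vol_norm_sq \<T> u" and "B = vol_norm_sq \<T> v" and "p = vol_ip \<T> u v"
  have quadratic: "0 \<le> A - 2 * t * p + t\<^sup>2 * B" for t
    using vol_norm_sq_nonneg[of \<T> "\<lambda>x. u x - t *\<^sub>R v x"]
    unfolding vol_norm_sq_diff_scaled[OF assms] A_def B_def p_def .
  have "p\<^sup>2 \<le> A * B"
  proof (cases "B = 0")
    case True
    have "p = 0"
    proof (rule ccontr)
      \<comment> \<open>The polynomial is then affine in \<open>t\<close>; it takes the value \<open>-1\<close> at this point.\<close>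
      assume "p \<noteq> 0"
      then show False
        using quadratic[of "(A + 1) / (2 * p)"] True by simp
    qed
    then show ?thesis
      using True by simp
  next
    case False
    then have "0 < B"
      using vol_norm_sq_nonneg[of \<T> v] unfolding B_def by simp
    then show ?thesis
      using quadratic[of "p / B"] by (simp add: field_simps power2_eq_square)
  qed
  then have "\<bar>p\<bar> \<le> sqrt (A * B)"
    by (rule real_le_rsqrt[of "\<bar>p\<bar>", simplified])
  then show ?thesis
    unfolding A_def B_def p_def by (simp add: real_sqrt_mult)
qed

section \<open>The energy inequality for one time step\<close>

text \<open>
  The four terms form two pairs of opposite sign, one of volume and one of boundary integrals.
  On the diagonal the integrands of a pair agree pointwise: each is the same product of the
  convection field with a gradient or a normal and with two scalar factors.
\<close>
lemma B_form_diagonal: "B_form \<T> \<E> v u u' u u' = 0"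
proof -
  have "vol_ip \<T> (\<lambda>x. u x *\<^sub>R b_vec (v x)) (grad u) = vol_ip \<T> (\<lambda>x. b_vec (v x) \<bullet> grad u x) u"
    unfolding vol_ip_def by (simp add: mult.commute)
  moreover have
    "bdry_ip \<T> \<E> (\<lambda>K x. (b_vec (trace_from K v x) \<bullet> outer_normal K x) * trace_from K u x) (\<lambda>K. u')
     = bdry_ip \<T> \<E> (\<lambda>K x. (b_vec (trace_from K v x) \<bullet> outer_normal K x) * u' x)
         (\<lambda>K. trace_from K u)"
    unfolding bdry_ip_def by (simp add: mult_ac)
  ultimately show ?thesis
    unfolding B_form_def by simp
qed

text \<open>
  Writing the weight \<open>1 / h\<^sub>K\<close> as a square needs \<open>h\<^sub>K \<ge> 0\<close>.
\<close>
lemma S_form_diagonal: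
  assumes "\<And>K. K \<in> \<T> \<Longrightarrow> polyhedral_domain K"
  shows "S_form \<T> \<E> l \<nu> u u' u u' = \<nu> * bdry_norm_sq \<T> \<E>
    (\<lambda>K x. sqrt (inverse (elem_size K)) * (bdry_proj \<E> l K (trace_from K u) x - u' x))"
proof -
  have "inverse (elem_size K) * s * s = (norm (sqrt (inverse (elem_size K)) * s))\<^sup>2"
    if "K \<in> \<T>" for K and s :: real
    using elem_size_nonneg[OF assms[OF that]]
    by (simp add: power_mult_distrib real_sqrt_pow2 power2_eq_square[of s] flip: real_sqrt_inverse)
  then show ?thesis
    unfolding S_form_def bdry_ip_def bdry_norm_sq_def by simp
qed

lemma energy_norm_sq_nonneg: "0 \<le> energy_norm_sq \<Omega> \<T> \<E> k l w \<mu>"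
  unfolding energy_norm_sq_def bdry_norm_sq_def set_lebesgue_integral_def
  by (intro add_nonneg_nonneg vol_norm_sq_nonneg sum_nonneg Bochner_Integration.integral_nonneg)
    simp

lemma euler_step_energy:
  assumes mesh: "polytopal_mesh \<Omega> \<T> \<E>"
    and sol: "euler_hdg_solution \<Omega> \<T> \<E> k l \<nu> \<Delta>t N f u0 q u u'"
    and n: "n \<in> {1..N}" and f: "f n \<in> L2_on lebesgue \<Omega>" and "0 < \<Delta>t"
  shows "vol_norm_sq \<T> (u n) - vol_norm_sq \<T> (u (n - 1))
      + vol_norm_sq \<T> (\<lambda>x. u n x - u (n - 1) x)
      + 2 * \<nu> * \<Delta>t * energy_norm_sq \<Omega> \<T> \<E> k l (u n) (u' n)
    \<le> 2 * \<Delta>t * (sqrt (vol_norm_sq \<T> (f n)) * sqrt (vol_norm_sq \<T> (u n)))"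
proof -
  have elements: "polyhedral_domain K" "K \<subseteq> \<Omega>" if "K \<in> \<T>" for K
    using mesh that unfolding polytopal_mesh_def by auto
  then interpret open_elements \<Omega> \<T>
    by unfold_locales (auto intro: polyhedral_domain_open)
  have u: "u m \<in> V_space \<Omega> \<T> k" if "m \<le> N" for m
  proof (cases "m = 0")
    case True
    then show ?thesis
      using sol unfolding euler_hdg_solution_def is_vol_proj_def by simp
  next
    case False
    then show ?thesis
      using sol that unfolding euler_hdg_solution_def by simp
  qed
  then have L2: "u n \<in> L2_on lebesgue \<Omega>" "u (n - 1) \<in> L2_on lebesgue \<Omega>"
    using n unfolding V_space_def by auto
  define E where "E = energy_norm_sq \<Omega> \<T> \<E> k l (u n) (u' n)"
  have "u' n \<in> Vhat_space \<Omega> \<E> l"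
    using sol n unfolding euler_hdg_solution_def by blast
  then have "vol_ip \<T> (\<lambda>x. (u n x - u (n - 1) x) / \<Delta>t) (u n)
      + \<nu> * vol_ip \<T> (K_op \<Omega> \<T> \<E> k (u n) (u' n)) (K_op \<Omega> \<T> \<E> k (u n) (u' n))
      + S_form \<T> \<E> l \<nu> (u n) (u' n) (u n) (u' n)
      + B_form \<T> \<E> (u (n - 1)) (u n) (u' n) (u n) (u' n) = vol_ip \<T> (f n) (u n)"
    using sol n u[of n] unfolding euler_hdg_solution_def by simp
  then have tested: "vol_ip \<T> (\<lambda>x. (u n x - u (n - 1) x) / \<Delta>t) (u n) + \<nu> * E
      = vol_ip \<T> (f n) (u n)"
    using S_form_diagonal[of \<T> \<E> l \<nu>] elements
    unfolding E_def energy_norm_sq_def by (simp add: B_form_diagonal vol_ip_self algebra_simps)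
  have quotient: "\<Delta>t * vol_ip \<T> (\<lambda>x. (u n x - u (n - 1) x) / \<Delta>t) (u n)
      = vol_norm_sq \<T> (u n) - vol_ip \<T> (u n) (u (n - 1))"
    using vol_ip_diff_scaled[OF L2 L2(1), of "1 / \<Delta>t"] \<open>0 < \<Delta>t\<close>
      vol_ip_commute[of \<T> "u n" "u (n - 1)"]
    by (simp add: vol_ip_self)
  have increment: "vol_norm_sq \<T> (\<lambda>x. u n x - u (n - 1) x)
      = vol_norm_sq \<T> (u n) - 2 * vol_ip \<T> (u n) (u (n - 1)) + vol_norm_sq \<T> (u (n - 1))"
    using vol_norm_sq_diff_scaled[OF L2, of 1] by simp
  have "vol_norm_sq \<T> (u n) - vol_norm_sq \<T> (u (n - 1))
      + vol_norm_sq \<T> (\<lambda>x. u n x - u (n - 1) x) + 2 * \<nu> * \<Delta>t * E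
    = 2 * \<Delta>t * vol_ip \<T> (f n) (u n)"
    using quotient increment unfolding tested[symmetric] by (simp add: algebra_simps)
  also have "\<dots> \<le> 2 * \<Delta>t * (sqrt (vol_norm_sq \<T> (f n)) * sqrt (vol_norm_sq \<T> (u n)))"
    using vol_ip_Cauchy_Schwarz[OF f L2(1)] \<open>0 < \<Delta>t\<close> by simp
  finally show ?thesis
    unfolding E_def .
qed

section \<open>Summation over the time steps\<close>

text \<open>
  From \<open>a\<^sub>n\<^sup>2 - a\<^sub>n\<^sub>-\<^sub>1\<^sup>2 \<le> 2 s\<^sub>n a\<^sub>n \<le> 2 s\<^sub>n (a\<^sub>n + a\<^sub>n\<^sub>-\<^sub>1)\<close> one factor
  can be cancelled, so the growth of \<open>a\<close> is linear in the data and no exponential factor arises.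
  Here \<open>D\<close> collects the squared increments and the energy norms.
\<close>
lemma discrete_energy_growth:
  fixes a s D :: "nat \<Rightarrow> real"
  assumes nonneg: "\<And>i. 0 \<le> a i" "\<And>i. 0 \<le> s i" "\<And>i. 0 \<le> D i"
    and step: "\<And>i. i \<in> {1..n} \<Longrightarrow> (a i)\<^sup>2 - (a (i - 1))\<^sup>2 + D i \<le> 2 * (s i * a i)"
    and "m \<le> n"
  shows "a m \<le> a 0 + 2 * (\<Sum>i=1..m. s i)"
  using \<open>m \<le> n\<close>
proof (induction m)
  case 0
  then show ?case by simp
next
  case (Suc m)
  have "a (Suc m) \<le> a m + 2 * s (Suc m)"
  proof (rule ccontr)
    assume "\<not> ?thesis"
    then have less: "2 * s (Suc m) < a (Suc m) - a m"
      by simp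
    then have "0 < a (Suc m) + a m"
      using nonneg(1)[of m] nonneg(2)[of "Suc m"] by linarith
    have "2 * (s (Suc m) * a (Suc m)) \<le> 2 * s (Suc m) * (a (Suc m) + a m)"
      using nonneg by (simp add: distrib_left)
    also have "\<dots> < (a (Suc m) - a m) * (a (Suc m) + a m)"
      using less \<open>0 < a (Suc m) + a m\<close> by (rule mult_strict_right_mono)
    also have "\<dots> = (a (Suc m))\<^sup>2 - (a m)\<^sup>2"
      by (simp add: power2_eq_square algebra_simps)
    finally show False
      using step[of "Suc m"] nonneg(3)[of "Suc m"] Suc.prems by simp
  qed
  then show ?case
    using Suc by simp
qed

lemma discrete_energy_estimate:
  fixes a s D :: "nat \<Rightarrow> real"
  assumes nonneg: "\<And>i. 0 \<le> a i" "\<And>i. 0 \<le> s i" "\<And>i. 0 \<le> D i"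
    and step: "\<And>i. i \<in> {1..n} \<Longrightarrow> (a i)\<^sup>2 - (a (i - 1))\<^sup>2 + D i \<le> 2 * (s i * a i)"
  shows "(a n)\<^sup>2 + (\<Sum>i=1..n. D i) \<le> 2 * (a 0)\<^sup>2 + 8 * (real n * (\<Sum>i=1..n. (s i)\<^sup>2))"
proof -
  define S where "S = (\<Sum>i=1..n. s i)"
  have "0 \<le> S"
    unfolding S_def using nonneg by (simp add: sum_nonneg)
  have bound: "a i \<le> a 0 + 2 * S" if "i \<in> {1..n}" for i
  proof -
    have "(\<Sum>j=1..i. s j) \<le> S"
      unfolding S_def using that nonneg by (intro sum_mono2) auto
    then show ?thesis
      using discrete_energy_growth[of a s D n i, OF nonneg step] that by fastforce
  qed
  have telescope: "(\<Sum>i=1..n. (a i)\<^sup>2 - (a (i - 1))\<^sup>2) = (a n)\<^sup>2 - (a 0)\<^sup>2"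
    by (induction n) auto
  have "(\<Sum>i=1..n. (a i)\<^sup>2 - (a (i - 1))\<^sup>2 + D i) \<le> (\<Sum>i=1..n. 2 * (s i * (a 0 + 2 * S)))"
  proof (rule sum_mono)
    fix i
    assume i: "i \<in> {1..n}"
    show "(a i)\<^sup>2 - (a (i - 1))\<^sup>2 + D i \<le> 2 * (s i * (a 0 + 2 * S))"
      using step[OF i] mult_left_mono[OF bound[OF i] nonneg(2)[of i]] by linarith
  qed
  also have "\<dots> = 2 * S * (a 0 + 2 * S)"
    unfolding S_def by (simp add: sum_distrib_left sum_distrib_right mult_ac)
  finally have "(a n)\<^sup>2 + (\<Sum>i=1..n. D i) \<le> (a 0)\<^sup>2 + 2 * S * (a 0 + 2 * S)"
    using telescope by (simp add: sum.distrib)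
  also have "\<dots> \<le> 2 * (a 0)\<^sup>2 + 8 * S\<^sup>2"
  proof -
    \<comment> \<open>the difference of the two sides\<close>
    have "0 \<le> (a 0 - S)\<^sup>2 + 3 * S\<^sup>2"
      by simp
    then show ?thesis
      by (simp add: power2_eq_square algebra_simps)
  qed
  also have "S\<^sup>2 \<le> real n * (\<Sum>i=1..n. (s i)\<^sup>2)"
    using sum_squared_le_sum_of_squares[of s "{1..n}"] unfolding S_def
    by (simp add: mult.commute)
  finally show ?thesis
    by simp
qed

section \<open>Stability of the scheme\<close>

theorem theorem4p1:
  fixes \<Omega> :: "(real^'d) set" and \<theta> lstar \<nu> T :: real and k l :: nat
  assumes "CARD('d) = 2 \<or> CARD('d) = 3"
    and "polyhedral_domain \<Omega>"
    and "0 < \<theta>" and "0 < lstar"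
    and "1 \<le> k" and "l = k - 1 \<or> l = k"
    and "0 < \<nu>" and "0 < T"
  shows "\<exists>C>0. \<forall>(\<T> :: (real^'d) set set) (\<E> :: (real^'d) set set) (N :: nat) (\<Delta>t :: real)
      (f :: real \<Rightarrow> real^'d \<Rightarrow> real) (u0 :: real^'d \<Rightarrow> real)
      (q :: nat \<Rightarrow> real^'d \<Rightarrow> real^'d) (u :: nat \<Rightarrow> real^'d \<Rightarrow> real) (u' :: nat \<Rightarrow> real^'d \<Rightarrow> real).
      polytopal_mesh \<Omega> \<T> \<E> \<and> shape_regular \<theta> lstar \<T> \<E> \<and>
      1 \<le> N \<and> \<Delta>t = T / real N \<and>
      (\<forall>n\<in>{1..N}. f (real n * \<Delta>t) \<in> L2_on lebesgue \<Omega>) \<and> u0 \<in> L2_on lebesgue \<Omega> \<and>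
      euler_hdg_solution \<Omega> \<T> \<E> k l \<nu> \<Delta>t N (\<lambda>n. f (real n * \<Delta>t)) u0 q u u' \<longrightarrow>
      (\<forall>n\<in>{1..N}.
         vol_norm_sq \<T> (u n)
         + (\<Sum>i=1..n. vol_norm_sq \<T> (\<lambda>x. u i x - u (i - 1) x))
         + \<nu> * \<Delta>t * (\<Sum>i=1..n. energy_norm_sq \<Omega> \<T> \<E> k l (u i) (u' i))
         \<le> C * (vol_norm_sq \<T> (u 0)
                + \<Delta>t / \<nu> * (\<Sum>i=1..n. vol_norm_sq \<T> (f (real i * \<Delta>t)))))"
proof (intro exI[of _ "2 + 8 * \<nu> * T"] conjI allI impI ballI)
  show "0 < 2 + 8 * \<nu> * T"
    using assms by (simp add: add_pos_pos)
next
  fix \<T> \<E> :: "(real^'d) set set" and N n :: nat and \<Delta>t :: real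
    and f :: "real \<Rightarrow> real^'d \<Rightarrow> real" and u0 :: "real^'d \<Rightarrow> real"
    and q :: "nat \<Rightarrow> real^'d \<Rightarrow> real^'d" and u u' :: "nat \<Rightarrow> real^'d \<Rightarrow> real"
  assume H: "polytopal_mesh \<Omega> \<T> \<E> \<and> shape_regular \<theta> lstar \<T> \<E> \<and>
      1 \<le> N \<and> \<Delta>t = T / real N \<and>
      (\<forall>n\<in>{1..N}. f (real n * \<Delta>t) \<in> L2_on lebesgue \<Omega>) \<and> u0 \<in> L2_on lebesgue \<Omega> \<and>
      euler_hdg_solution \<Omega> \<T> \<E> k l \<nu> \<Delta>t N (\<lambda>n. f (real n * \<Delta>t)) u0 q u u'"
    and n: "n \<in> {1..N}"
  then have "0 < \<Delta>t"
    using \<open>0 < T\<close> by simp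
  define g where "g i = vol_norm_sq \<T> (f (real i * \<Delta>t))" for i
  define d where "d i = vol_norm_sq \<T> (\<lambda>x. u i x - u (i - 1) x)" for i
  define e where "e i = energy_norm_sq \<Omega> \<T> \<E> k l (u i) (u' i)" for i
  have nonneg: "0 \<le> g i" "0 \<le> d i" "0 \<le> e i" for i
    unfolding g_def d_def e_def by (simp_all add: vol_norm_sq_nonneg energy_norm_sq_nonneg)
  have "vol_norm_sq \<T> (u n) + (\<Sum>i=1..n. d i + 2 * \<nu> * \<Delta>t * e i)
      \<le> 2 * vol_norm_sq \<T> (u 0) + 8 * (real n * (\<Sum>i=1..n. \<Delta>t\<^sup>2 * g i))"
  proof -
    have "(sqrt (vol_norm_sq \<T> (u i)))\<^sup>2 - (sqrt (vol_norm_sq \<T> (u (i - 1))))\<^sup>2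
        + (d i + 2 * \<nu> * \<Delta>t * e i) \<le> 2 * ((\<Delta>t * sqrt (g i)) * sqrt (vol_norm_sq \<T> (u i)))"
      if "i \<in> {1..n}" for i
    proof -
      have "i \<in> {1..N}"
        using n that by simp
      then have "vol_norm_sq \<T> (u i) - vol_norm_sq \<T> (u (i - 1)) + d i + 2 * \<nu> * \<Delta>t * e i
          \<le> 2 * \<Delta>t * (sqrt (g i) * sqrt (vol_norm_sq \<T> (u i)))"
        using H \<open>0 < \<Delta>t\<close> unfolding d_def e_def g_def
        by (intro euler_step_energy[where f = "\<lambda>n. f (real n * \<Delta>t)"]) blast+
      then show ?thesis
        by (simp add: vol_norm_sq_nonneg mult.assoc)
    qed
    then have "(sqrt (vol_norm_sq \<T> (u n)))\<^sup>2 + (\<Sum>i=1..n. d i + 2 * \<nu> * \<Delta>t * e i)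
        \<le> 2 * (sqrt (vol_norm_sq \<T> (u 0)))\<^sup>2 + 8 * (real n * (\<Sum>i=1..n. (\<Delta>t * sqrt (g i))\<^sup>2))"
      using nonneg \<open>0 < \<Delta>t\<close> \<open>0 < \<nu>\<close>
      by (intro discrete_energy_estimate) (simp_all add: vol_norm_sq_nonneg)
    then show ?thesis
      using nonneg by (simp add: vol_norm_sq_nonneg power_mult_distrib)
  qed
  moreover have "real n * (\<Sum>i=1..n. \<Delta>t\<^sup>2 * g i) \<le> T * (\<Delta>t * (\<Sum>i=1..n. g i))"
  proof -
    have "real n * \<Delta>t \<le> real N * \<Delta>t"
      using n \<open>0 < \<Delta>t\<close> by simp
    also have "\<dots> = T"
      using H by simp
    finally have "(real n * \<Delta>t) * (\<Delta>t * (\<Sum>i=1..n. g i)) \<le> T * (\<Delta>t * (\<Sum>i=1..n. g i))"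
      using nonneg \<open>0 < \<Delta>t\<close> by (intro mult_right_mono) (simp_all add: sum_nonneg)
    then show ?thesis
      by (simp add: power2_eq_square mult_ac flip: sum_distrib_left)
  qed
  moreover have "0 \<le> \<nu> * \<Delta>t * (\<Sum>i=1..n. e i)"
    using nonneg \<open>0 < \<Delta>t\<close> \<open>0 < \<nu>\<close> by (simp add: sum_nonneg)
  moreover have "(\<Sum>i=1..n. d i + 2 * \<nu> * \<Delta>t * e i)
      = (\<Sum>i=1..n. d i) + 2 * (\<nu> * \<Delta>t * (\<Sum>i=1..n. e i))"
    by (simp add: sum.distrib sum_distrib_left mult_ac)
  ultimately have "vol_norm_sq \<T> (u n) + (\<Sum>i=1..n. d i) + \<nu> * \<Delta>t * (\<Sum>i=1..n. e i)
      \<le> 2 * vol_norm_sq \<T> (u 0) + 8 * (T * (\<Delta>t * (\<Sum>i=1..n. g i)))"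
    by linarith
  \<comment> \<open>In terms of the right-hand side of the estimate, \<open>T \<Delta>t = \<nu> T (\<Delta>t / \<nu>)\<close>.\<close>
  also have "8 * (T * (\<Delta>t * (\<Sum>i=1..n. g i))) = 8 * \<nu> * T * (\<Delta>t / \<nu> * (\<Sum>i=1..n. g i))"
    using \<open>0 < \<nu>\<close> by simp
  also have "2 * vol_norm_sq \<T> (u 0) + \<dots>
      \<le> (2 + 8 * \<nu> * T) * (vol_norm_sq \<T> (u 0) + \<Delta>t / \<nu> * (\<Sum>i=1..n. g i))"
  proof -
    have "0 \<le> \<Delta>t / \<nu> * (\<Sum>i=1..n. g i)" "0 \<le> 8 * \<nu> * T * vol_norm_sq \<T> (u 0)"
      using nonneg \<open>0 < \<Delta>t\<close> \<open>0 < \<nu>\<close> \<open>0 < T\<close> by (simp_all add: sum_nonneg vol_norm_sq_nonneg)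
    then show ?thesis
      unfolding distrib_left distrib_right by linarith
  qed
  finally show "vol_norm_sq \<T> (u n)
      + (\<Sum>i=1..n. vol_norm_sq \<T> (\<lambda>x. u i x - u (i - 1) x))
      + \<nu> * \<Delta>t * (\<Sum>i=1..n. energy_norm_sq \<Omega> \<T> \<E> k l (u i) (u' i))
    \<le> (2 + 8 * \<nu> * T) * (vol_norm_sq \<T> (u 0)
        + \<Delta>t / \<nu> * (\<Sum>i=1..n. vol_norm_sq \<T> (f (real i * \<Delta>t))))"
    unfolding d_def e_def g_def .
qed

end
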